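(* For every real $p>0$, $$\int_0^\infty \left(\sqrt{\pi}\, e^{-x^2/p}+p^2\sqrt{p}\,\pi^{-2}e^{-px^2/\pi^2}\right)\frac{x^2}{\cosh x}\,dx=\frac{p\pi \sqrt{p}}{2}\int_0^\infty \frac{e^{-px^2}}{\cosh \pi x}\,dx.$$
   Context: $\cosh$ is the hyperbolic cosine and $\cosh \pi x=\cosh(\pi x)$. *)

theory Defs
  imports "HOL-Analysis.Analysis"
begin

end

theory Submission
  imports Defs "HOL-Probability.Probability" "HOL-Real_Asymp.Real_Asymp"
begin

text \<open>
  The hyperbolic secant is, up to scaling, its own cosine transform:
  \<open>\<integral> cos (t x) / cosh x dx = \<pi> / cosh (\<pi> t / 2)\<close> over the real line. Expanding \<open>1 / cosh x\<close> as a finite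
  geometric sum with remainder turns the left-hand side into the partial fraction series of the
  secant, which is summed by the reflection formula of the Digamma function. Fubini's theorem
  then gives \<open>\<pi> \<integral> g(x) / cosh x dx = \<integral> G(2 u / \<pi>) / cosh u du\<close>, where \<open>G\<close> is the cosine transform
  of \<open>g\<close>. For \<open>g(x) = x\<^sup>2 exp (- x\<^sup>2 / p)\<close> the function \<open>G\<close> is a quadratic polynomial times a Gaussian;
  its constant and quadratic terms yield the right-hand side and the second summand of the
  left-hand side of the claim.
\<close>

section \<open>Gaussian moments and their cosine transforms\<close>

text \<open>Stands in for integration by parts: applied to a power times a Gaussian times
  \<open>sin\<close> or \<open>cos\<close>, it yields a linear relation between trigonometric
  moments.\<close>

lemma integral_eq_zero_of_derivative:
  fixes f F :: "real \<Rightarrow> real"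
  assumes "\<And>x. (F has_real_derivative f x) (at x)"
    and "continuous_on UNIV f" and "integrable lborel f"
    and "(F \<longlongrightarrow> 0) at_bot" and "(F \<longlongrightarrow> 0) at_top"
  shows "(\<integral>x. f x \<partial>lborel) = 0"
proof -
  have "(LBINT x=-\<infinity>..\<infinity>. f x) = 0 - 0"
  proof (rule interval_integral_FTC_integrable)
    show "(F has_vector_derivative f x) (at x)" for x
      using assms(1) by (simp add: has_real_derivative_iff_has_vector_derivative)
    show "isCont f x" for x
      using assms(2) by (simp add: continuous_on_eq_continuous_at)
  qed (use assms in \<open>auto simp: set_integrable_def ereal_tendsto_simps1\<close>)
  then show ?thesis
    by (simp add: interval_lebesgue_integral_def set_lebesgue_integral_def)
qed

lemma gaussian_moment_integrable:
  fixes a :: real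
  assumes "a > 0"
  shows "integrable lborel (\<lambda>x. x ^ k * exp (- a * x\<^sup>2))"
proof -
  \<comment> \<open>The standard deviation for which \<open>1 / (2 * s\<^sup>2) = a\<close>, so the
    integrand is an unnormalised moment of a centred normal density.\<close>
  define s where "s = 1 / sqrt (2 * a)"
  have s: "s > 0" "s\<^sup>2 = 1 / (2 * a)"
    using assms by (auto simp: s_def power_divide)
  have "integrable lborel (\<lambda>x. sqrt (2 * pi * s\<^sup>2) * (normal_density 0 s x * (x - 0) ^ k))"
    using s by (intro integrable_mult_right integrable_normal_moment)
  also have "(\<lambda>x. sqrt (2 * pi * s\<^sup>2) * (normal_density 0 s x * (x - 0) ^ k))
      = (\<lambda>x. x ^ k * exp (- a * x\<^sup>2))"
    using s assms by (auto simp: normal_density_def fun_eq_iff)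
  finally show ?thesis .
qed

text \<open>After rescaling by \<open>c = sqrt (2 * a)\<close> the integral is the real part of the
  characteristic function of the standard normal distribution at \<open>t / c\<close>, which is
  known in closed form.\<close>

lemma gaussian_cos_integral:
  fixes a t :: real
  assumes "a > 0"
  shows "(\<integral>x. exp (- a * x\<^sup>2) * cos (t * x) \<partial>lborel) = sqrt (pi / a) * exp (- t\<^sup>2 / (4 * a))"
proof -
  interpret real_distribution std_normal_distribution
    by (rule real_dist_normal_dist)
  define c where "c = sqrt (2 * a)"
  have c: "c > 0" "c\<^sup>2 = 2 * a"
    using assms by (auto simp: c_def)
  have "Re (char std_normal_distribution (t / c)) = (\<integral>x. cos (t / c * x) \<partial>std_normal_distribution)"
    unfolding char_def using integrable_iexp[of "\<lambda>x. t / c * x"]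
    by (subst integral_Re[symmetric]) (auto simp: Re_exp)
  also have "\<dots> = (\<integral>x. std_normal_density x * cos (t / c * x) \<partial>lborel)"
    by (subst integral_density) auto
  also have "\<dots> = c * (\<integral>x. std_normal_density (c * x) * cos (t * x) \<partial>lborel)"
    using c by (subst lborel_integral_real_affine[of c _ 0]) auto
  also have "\<dots> = c * (\<integral>x. 1 / sqrt (2 * pi) * (exp (- a * x\<^sup>2) * cos (t * x)) \<partial>lborel)"
    using c by (simp add: std_normal_density_def power_mult_distrib mult.assoc)
  also have "\<dots> = c / sqrt (2 * pi) * (\<integral>x. exp (- a * x\<^sup>2) * cos (t * x) \<partial>lborel)"
    by (subst integral_mult_right_zero) simp
  also have "c / sqrt (2 * pi) = sqrt (a / pi)"
    by (simp add: c_def real_sqrt_divide[symmetric])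
  finally have "exp (- t\<^sup>2 / (4 * a)) = sqrt (a / pi) * (\<integral>x. exp (- a * x\<^sup>2) * cos (t * x) \<partial>lborel)"
    using c by (simp add: char_std_normal_distribution power_divide)
  then have "sqrt (pi / a) * exp (- t\<^sup>2 / (4 * a)) = (sqrt (pi / a) * sqrt (a / pi)) * (\<integral>x. exp (- a * x\<^sup>2) * cos (t * x) \<partial>lborel)"
    by simp
  also have "sqrt (pi / a) * sqrt (a / pi) = 1"
    using assms by (simp add: real_sqrt_mult[symmetric])
  finally show ?thesis by simp
qed

lemma gaussian_moment_trig_integrable:
  fixes a t :: real
  assumes "a > 0"
  shows "integrable lborel (\<lambda>x. x ^ k * exp (- a * x\<^sup>2) * cos (t * x))"
    and "integrable lborel (\<lambda>x. x ^ k * exp (- a * x\<^sup>2) * sin (t * x))"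
  by (rule Bochner_Integration.integrable_bound[OF gaussian_moment_integrable[OF assms, of k]];
      auto simp: abs_mult intro!: AE_I2 mult_left_le)+

text \<open>The derivatives of \<open>?e x * sin (t * x)\<close> and
  \<open>x * ?e x * cos (t * x)\<close> integrate to zero. This gives
  \<open>t * G = 2 * a * S\<close> and \<open>G - t * S = 2 * a * M\<close>; eliminating
  \<open>S\<close> expresses \<open>M\<close> through the known \<open>G\<close>.\<close>

lemma gaussian_sq_cos_integral:
  fixes a t :: real
  assumes "a > 0"
  shows "(\<integral>x. x\<^sup>2 * exp (- a * x\<^sup>2) * cos (t * x) \<partial>lborel)
    = (1 / (2 * a) - t\<^sup>2 / (4 * a\<^sup>2)) * (sqrt (pi / a) * exp (- t\<^sup>2 / (4 * a)))"
proof -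
  let ?e = "\<lambda>x. exp (- a * x\<^sup>2)"
  define G S M where "G = (\<integral>x. ?e x * cos (t * x) \<partial>lborel)"
    and "S = (\<integral>x. x * ?e x * sin (t * x) \<partial>lborel)"
    and "M = (\<integral>x. x\<^sup>2 * ?e x * cos (t * x) \<partial>lborel)"
  note int = gaussian_moment_trig_integrable[OF assms, of 0 t] gaussian_moment_trig_integrable[OF assms, of 1 t]
    gaussian_moment_trig_integrable[OF assms, of 2 t]
  \<comment> \<open>Boundary values of both antiderivatives: \<open>k = 0\<close> goes with
    \<open>sin\<close>, \<open>k = 1\<close> with \<open>cos\<close>. The powers
    \<open>x ^ 0\<close> and \<open>x ^ 1\<close> below are spelled out to match this form.\<close>
  have lim: "((\<lambda>x. x ^ k * ?e x * g (t * x)) \<longlongrightarrow> 0) F"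
    if "F = at_top \<or> F = at_bot" "k \<le> 1" "\<And>x. \<bar>g x\<bar> \<le> 1" for F and k :: nat and g :: "real \<Rightarrow> real"
  proof (rule Lim_null_comparison)
    show "\<forall>\<^sub>F x in F. norm (x ^ k * ?e x * g (t * x)) \<le> \<bar>x ^ k * ?e x\<bar>"
      using that(3) by (auto simp: abs_mult intro!: always_eventually mult_left_le)
    have "k = 0 \<or> k = 1" using that by auto
    then have "((\<lambda>x. x ^ k * ?e x) \<longlongrightarrow> 0) F"
      using that(1) assms by (elim disjE; simp; real_asymp)
    then show "((\<lambda>x. \<bar>x ^ k * ?e x\<bar>) \<longlongrightarrow> 0) F"
      by (rule tendsto_rabs_zero)
  qed
  have "(\<integral>x. (t * (?e x * cos (t * x)) - 2 * a * (x * ?e x * sin (t * x))) \<partial>lborel) = 0"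
  proof (rule integral_eq_zero_of_derivative)
    show "((\<lambda>x. x ^ 0 * ?e x * sin (t * x)) has_real_derivative
        t * (?e x * cos (t * x)) - 2 * a * (x * ?e x * sin (t * x))) (at x)" for x
      by (auto intro!: derivative_eq_intros simp: algebra_simps)
  qed (use int lim[of _ 0 sin] in \<open>auto intro!: continuous_intros\<close>)
  then have "t * G - 2 * a * S = 0"
    using int by (simp add: G_def S_def)
  moreover have "(\<integral>x. (?e x * cos (t * x) - t * (x * ?e x * sin (t * x)) - 2 * a * (x\<^sup>2 * ?e x * cos (t * x))) \<partial>lborel) = 0"
  proof (rule integral_eq_zero_of_derivative)
    show "((\<lambda>x. x ^ 1 * ?e x * cos (t * x)) has_real_derivative
        ?e x * cos (t * x) - t * (x * ?e x * sin (t * x)) - 2 * a * (x\<^sup>2 * ?e x * cos (t * x))) (at x)" for x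
      by (auto intro!: derivative_eq_intros simp: algebra_simps power2_eq_square)
  qed (use int lim[of _ 1 cos] in \<open>auto intro!: continuous_intros\<close>)
  then have "G - t * S - 2 * a * M = 0"
    using int by (simp add: G_def S_def M_def)
  ultimately have "M = (1 / (2 * a) - t\<^sup>2 / (4 * a\<^sup>2)) * G"
    using assms by (simp add: field_simps power2_eq_square) algebra
  then show ?thesis
    unfolding M_def G_def gaussian_cos_integral[OF assms] .
qed

section \<open>The partial fraction series of the hyperbolic secant\<close>

text \<open>Differentiate both sides of \<open>Gamma z * Gamma (1 - z) = pi / sin (pi * z)\<close>;
  each derivative is the function times its logarithmic derivative, and the common nonzero factor
  cancels.\<close>

lemma Digamma_reflection:
  fixes z :: complex
  assumes "z \<notin> \<int>"
  shows "Digamma (1 - z) - Digamma z = pi * cot (pi * z)"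
proof -
  have nz: "sin (of_real pi * z) \<noteq> 0"
    using assms by (auto simp: sin_eq_0)
  have z: "z \<notin> \<int>\<^sub>\<le>\<^sub>0" "1 - z \<notin> \<int>\<^sub>\<le>\<^sub>0"
    using assms nonpos_Ints_Int Ints_diff[of 1 "1 - z"] by auto
  have "((\<lambda>z. Gamma z * Gamma (1 - z)) has_field_derivative
     Gamma z * Gamma (1 - z) * (Digamma z - Digamma (1 - z))) (at z)"
    using z by (auto intro!: derivative_eq_intros simp: algebra_simps)
  moreover have "((\<lambda>z. of_real pi / sin (of_real pi * z)) has_field_derivative
     of_real pi / sin (of_real pi * z) * (- of_real pi * cot (of_real pi * z))) (at z)"
    using nz by (auto intro!: derivative_eq_intros simp: cot_def field_simps)
  ultimately have "of_real pi / sin (of_real pi * z) * (Digamma z - Digamma (1 - z))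
    = of_real pi / sin (of_real pi * z) * (- of_real pi * cot (of_real pi * z))"
    unfolding Gamma_reflection_complex by (rule DERIV_unique)
  then have "Digamma z - Digamma (1 - z) = - of_real pi * cot (of_real pi * z)"
    using nz by (subst (asm) mult_left_cancel) auto
  then show ?thesis by (simp add: algebra_simps)
qed

lemma Re_quarter_notin_Ints:
  fixes z :: complex
  assumes "Re z = 1 / 4"
  shows "z \<notin> \<int>"
proof
  assume "z \<in> \<int>"
  then obtain n where "z = of_int n" by (rule Ints_cases)
  then have "real_of_int (4 * n) = real_of_int 1" using assms by simp
  then have "4 * n = 1" unfolding of_int_eq_iff .
  then show False by presburger
qed

text \<open>Here \<open>z + w = 1 / 2\<close> and \<open>z - w = \<i> * t / 2\<close>. Over the
  common denominator the numerator is \<open>sin (pi / 2) = 1\<close>, and the product formula for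
  sines turns the denominator into \<open>cosh (pi * t / 2) / 2\<close>.\<close>

lemma cot_conjugate_sum:
  fixes t :: real and z w :: complex
  defines "z \<equiv> (1 + \<i> * t) / 4" and "w \<equiv> (1 - \<i> * t) / 4"
  shows "pi * cot (pi * w) + pi * cot (pi * z) = of_real (2 * pi / cosh (pi * t / 2))"
proof -
  have ns: "sin (complex_of_real pi * z) \<noteq> 0" "sin (complex_of_real pi * w) \<noteq> 0"
    using Re_quarter_notin_Ints[of z] Re_quarter_notin_Ints[of w] by (auto simp: sin_eq_0 z_def w_def)
  have "sin (pi * z) * sin (pi * w) = (cos (pi * (z - w)) - cos (pi * (z + w))) / 2"
    by (simp add: right_diff_distrib distrib_left cos_add cos_diff)
  also have "pi * (z + w) = complex_of_real (pi / 2)"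
    by (simp add: z_def w_def field_simps)
  also have "cos (complex_of_real (pi / 2)) = 0"
    unfolding cos_of_real by simp
  also have "pi * (z - w) = \<i> * complex_of_real (pi * t / 2)"
    by (simp add: z_def w_def field_simps)
  also have "cos (\<i> * complex_of_real (pi * t / 2)) = of_real (cosh (pi * t / 2))"
    unfolding cosh_conv_cos[symmetric] by (simp add: cosh_field_def flip: exp_of_real)
  finally have ss: "sin (pi * z) * sin (pi * w) = of_real (cosh (pi * t / 2)) / 2"
    by simp
  have "cos (pi * w) * sin (pi * z) + cos (pi * z) * sin (pi * w) = sin (pi * (z + w))"
    by (simp add: distrib_left sin_add)
  also have "pi * (z + w) = complex_of_real (pi / 2)"
    by (simp add: z_def w_def field_simps)
  also have "sin (complex_of_real (pi / 2)) = 1"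
    unfolding sin_of_real by simp
  finally have num: "cos (pi * w) * sin (pi * z) + cos (pi * z) * sin (pi * w) = 1" .
  have "cot (pi * w) + cot (pi * z)
      = (cos (pi * w) * sin (pi * z) + cos (pi * z) * sin (pi * w)) / (sin (pi * z) * sin (pi * w))"
    using ns by (simp add: cot_def field_simps)
  also have "\<dots> = of_real (2 / cosh (pi * t / 2))"
    by (simp add: num ss)
  finally show ?thesis
    by (simp add: distrib_left[symmetric])
qed

text \<open>Each term splits into two conjugate simple poles. Sorting the odd numbers into
  \<open>4 * n + 1\<close> and \<open>4 * n + 3\<close> produces the series of
  \<open>Digamma\<close> at \<open>z\<close>, \<open>w\<close>, \<open>1 - w\<close> and
  \<open>1 - z\<close>, which reflection evaluates. Pairing the two classes is why the partial sums
  have even length.\<close>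

lemma sech_partial_fractions:
  fixes t :: real
  shows "(\<lambda>m. \<Sum>n<2*m. (-1) ^ n * (2 * real n + 1) / ((2 * real n + 1)\<^sup>2 + t\<^sup>2))
    \<longlonglongrightarrow> pi / (4 * cosh (pi * t / 2))"
proof -
  define z w where "z = (1 + \<i> * t) / 4" and "w = (1 - \<i> * t) / 4"
  define b where "b = (\<lambda>c::real. c / (c\<^sup>2 + t\<^sup>2))"
  have nonint: "z \<notin> \<int>" "w \<notin> \<int>"
    by (auto simp: z_def w_def intro!: Re_quarter_notin_Ints)
  \<comment> \<open>Approximants of \<open>Digamma\<close>; their logarithms cancel in the
    differences \<open>D (1 - w) m - D w m\<close> and \<open>D (1 - z) m - D z m\<close>.\<close>
  define D where "D = (\<lambda>z m. complex_of_real (ln (real m)) - (\<Sum>n<m. inverse (z + of_nat n)))"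
  have D: "D z \<longlonglongrightarrow> Digamma z" if "z \<noteq> 0" for z
    unfolding D_def using Digamma_LIMSEQ[OF that] by simp
  have "(\<lambda>m. (D (1 - w) m - D w m) + (D (1 - z) m - D z m)) \<longlonglongrightarrow>
    (Digamma (1 - w) - Digamma w) + (Digamma (1 - z) - Digamma z)"
    using nonint by (intro tendsto_intros D) auto
  also have "(Digamma (1 - w) - Digamma w) + (Digamma (1 - z) - Digamma z) = of_real (2 * pi / cosh (pi * t / 2))"
    unfolding Digamma_reflection[OF nonint(1)] Digamma_reflection[OF nonint(2)]
    using cot_conjugate_sum[of t] by (simp add: z_def w_def)
  also have "(\<lambda>m. (D (1 - w) m - D w m) + (D (1 - z) m - D z m))
      = (\<lambda>m. of_real (8 * (\<Sum>n<2*m. (-1) ^ n * b (2 * real n + 1))))"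
  proof
    fix m
    have pair: "inverse (complex_of_real (c / 4) + \<i> * t / 4) + inverse (complex_of_real (c / 4) - \<i> * t / 4)
        = of_real (8 * b c)" if "c > 0" for c
    proof -
      have "complex_of_real c + \<i> * t \<noteq> 0" "complex_of_real c - \<i> * t \<noteq> 0"
        using that by (auto simp: complex_eq_iff)
      then have "inverse (complex_of_real (c / 4) + \<i> * t / 4) + inverse (complex_of_real (c / 4) - \<i> * t / 4)
        = 8 * c / ((complex_of_real c + \<i> * t) * (complex_of_real c - \<i> * t))"
        by (simp add: field_simps)
      also have "(complex_of_real c + \<i> * t) * (complex_of_real c - \<i> * t) = of_real (c\<^sup>2 + t\<^sup>2)"
        by (simp add: algebra_simps power2_eq_square)
      finally show ?thesis by (simp add: b_def)
    qed
    have "(D (1 - w) m - D w m) + (D (1 - z) m - D z m)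
       = (\<Sum>n<m. (inverse (z + of_nat n) + inverse (w + of_nat n))
          - (inverse (1 - w + of_nat n) + inverse (1 - z + of_nat n)))"
      by (simp add: D_def sum.distrib sum_subtractf)
    also have "\<dots> = (\<Sum>n<m. of_real (8 * b (4 * real n + 1) - 8 * b (4 * real n + 3)))"
    proof (intro sum.cong refl)
      fix n
      have c: "4 * real n + 1 > 0" "4 * real n + 3 > 0"
        by auto
      have shift: "z + of_nat n = of_real ((4 * real n + 1) / 4) + \<i> * t / 4"
        "w + of_nat n = of_real ((4 * real n + 1) / 4) - \<i> * t / 4"
        "1 - w + of_nat n = of_real ((4 * real n + 3) / 4) + \<i> * t / 4"
        "1 - z + of_nat n = of_real ((4 * real n + 3) / 4) - \<i> * t / 4"
        by (simp_all add: z_def w_def field_simps)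
      show "(inverse (z + of_nat n) + inverse (w + of_nat n))
          - (inverse (1 - w + of_nat n) + inverse (1 - z + of_nat n)) = of_real (8 * b (4 * real n + 1) - 8 * b (4 * real n + 3))"
        unfolding shift pair[OF c(1)] pair[OF c(2)] by (simp only: of_real_diff)
    qed
    \<comment> \<open>Summand \<open>n\<close> on the left consists of the terms with indices
      \<open>2 * n\<close> (sign plus) and \<open>2 * n + 1\<close> (sign minus) on the
      right.\<close>
    also have "\<dots> = of_real (8 * (\<Sum>n<2*m. (-1) ^ n * b (2 * real n + 1)))"
      by (induction m) (auto simp: algebra_simps)
    finally show "(D (1 - w) m - D w m) + (D (1 - z) m - D z m)
      = of_real (8 * (\<Sum>n<2*m. (-1) ^ n * b (2 * real n + 1)))" .
  qed
  finally have "(\<lambda>m. 8 * (\<Sum>n<2*m. (-1) ^ n * b (2 * real n + 1)) / 8) \<longlonglongrightarrow> 2 * pi / cosh (pi * t / 2) / 8"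
    unfolding tendsto_of_real_iff by (intro tendsto_intros) auto
  then show ?thesis
    by (simp add: b_def)
qed

section \<open>The cosine transform of the hyperbolic secant\<close>

text \<open>Supplies dominating functions on the half-line and the size of the remainder in the
  secant expansion.\<close>

lemma has_bochner_integral_exp_minus_halfline:
  fixes c :: real
  assumes "c > 0"
  shows "has_bochner_integral lborel (\<lambda>x. indicator {0..} x * exp (- c * x)) (1 / c)"
proof -
  have "(\<integral>\<^sup>+x. ennreal (exp (- c * x)) * indicator {0..} x \<partial>lborel) = ennreal (0 - (- exp (- c * 0) / c))"
  proof (rule nn_integral_FTC_atLeast)
    show "((\<lambda>x. - exp (- c * x) / c) \<longlongrightarrow> 0) at_top"
      using assms by real_asymp
  qed (use assms in \<open>auto intro!: derivative_eq_intros\<close>)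
  then show ?thesis
    using assms by (intro has_bochner_integral_nn_integral)
      (auto simp: ennreal_mult' ennreal_indicator mult.commute)
qed

lemma has_bochner_integral_exp_cos_halfline:
  fixes c t :: real
  assumes "c > 0"
  shows "has_bochner_integral lborel (\<lambda>x. indicator {0..} x * (exp (- c * x) * cos (t * x))) (c / (c\<^sup>2 + t\<^sup>2))"
proof -
  have nz: "c\<^sup>2 + t\<^sup>2 > 0"
    using assms by (simp add: add_pos_nonneg)
  \<comment> \<open>The real part of \<open>exp ((- c + \<i> * t) * x) / (- c + \<i> * t)\<close>,
    hence an antiderivative of the integrand.\<close>
  let ?F = "\<lambda>x. exp (- c * x) * (t * sin (t * x) - c * cos (t * x)) / (c\<^sup>2 + t\<^sup>2)"
  have int: "integrable lborel (\<lambda>x. indicator {0..} x * (exp (- c * x) * cos (t * x)))"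
    by (rule Bochner_Integration.integrable_bound[OF
          integrable.intros[OF has_bochner_integral_exp_minus_halfline[OF assms]]])
       (auto simp: abs_mult indicator_def intro!: AE_I2 mult_left_le)
  \<comment> \<open>The fundamental theorem below works on the open half-line, the claim on the
    closed one; they differ by a null set.\<close>
  have AE: "AE x in lborel. indicator {0<..} x * (exp (- c * x) * cos (t * x)) = indicator {0..} x * (exp (- c * x) * cos (t * x))"
    using AE_lborel_singleton[of "0::real"] by eventually_elim (auto simp: indicator_def)
  have int': "integrable lborel (\<lambda>x. indicator {0<..} x * (exp (- c * x) * cos (t * x)))"
    using int by (subst integrable_cong_AE[OF _ _ AE]) auto
  have lim: "(?F \<longlongrightarrow> 0) at_top"
  proof (rule Lim_null_comparison)
    show "((\<lambda>x. exp (- c * x) * (\<bar>t\<bar> + c) / (c\<^sup>2 + t\<^sup>2)) \<longlongrightarrow> 0) at_top"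
    proof -
      have "((\<lambda>x. exp (- c * x)) \<longlongrightarrow> 0) at_top" using assms by real_asymp
      then show ?thesis by (intro tendsto_divide_zero tendsto_mult_left_zero)
    qed
    have "\<bar>t * sin (t * x) - c * cos (t * x)\<bar> \<le> \<bar>t\<bar> + c" for x
    proof -
      have "\<bar>t * sin (t * x) - c * cos (t * x)\<bar> \<le> \<bar>t * sin (t * x)\<bar> + \<bar>c * cos (t * x)\<bar>"
        by (rule abs_triangle_ineq4)
      also have "\<dots> \<le> \<bar>t\<bar> + c"
        using assms by (intro add_mono) (auto simp: abs_mult intro!: mult_left_le)
      finally show ?thesis .
    qed
    then show "\<forall>\<^sub>F x in at_top. norm (?F x) \<le> exp (- c * x) * (\<bar>t\<bar> + c) / (c\<^sup>2 + t\<^sup>2)"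
      using nz by (auto simp: abs_mult intro!: always_eventually divide_right_mono mult_left_mono)
  qed
  have "(LBINT x=0..\<infinity>. exp (- c * x) * cos (t * x)) = 0 - ?F 0"
  proof (rule interval_integral_FTC_integrable)
    show "(?F has_vector_derivative exp (- c * x) * cos (t * x)) (at x)" for x
    proof -
      have "((\<lambda>x. exp (- c * x) * (t * sin (t * x) - c * cos (t * x))) has_real_derivative
          exp (- c * x) * cos (t * x) * (c\<^sup>2 + t\<^sup>2)) (at x)"
        by (auto intro!: derivative_eq_intros simp: algebra_simps power2_eq_square)
      from DERIV_cdivide[OF this, of "c\<^sup>2 + t\<^sup>2"] show ?thesis
        using assms nz by (simp flip: has_real_derivative_iff_has_vector_derivative)
    qed
    show "((?F \<circ> real_of_ereal) \<longlongrightarrow> ?F 0) (at_right 0)"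
      unfolding zero_ereal_def ereal_tendsto_simps1
      using nz by (auto intro!: tendsto_eq_intros)
    show "((?F \<circ> real_of_ereal) \<longlongrightarrow> 0) (at_left \<infinity>)"
      unfolding ereal_tendsto_simps1 by (rule lim)
    show "set_integrable lborel (einterval 0 \<infinity>) (\<lambda>x. exp (- c * x) * cos (t * x))"
      using int' by (simp add: set_integrable_def zero_ereal_def)
  qed auto
  then have "(\<integral>x. indicator {0<..} x * (exp (- c * x) * cos (t * x)) \<partial>lborel) = c / (c\<^sup>2 + t\<^sup>2)"
    by (simp add: interval_lebesgue_integral_0_infty set_lebesgue_integral_def)
  also have "(\<integral>x. indicator {0<..} x * (exp (- c * x) * cos (t * x)) \<partial>lborel) = (\<integral>x. indicator {0..} x * (exp (- c * x) * cos (t * x)) \<partial>lborel)"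
    by (rule integral_cong_AE[OF _ _ AE]) auto
  finally show ?thesis
    using int by (simp add: has_bochner_integral_iff)
qed

lemma borel_measurable_cosh [measurable]: "(cosh :: real \<Rightarrow> real) \<in> borel_measurable borel"
  by (intro borel_measurable_continuous_onI continuous_intros)

text \<open>Multiplying by \<open>2 * cosh x\<close> makes the alternating sum telescope. The finite
  form with explicit remainder avoids exchanging an infinite series with the integral.\<close>

lemma inverse_cosh_geometric:
  fixes x :: real
  shows "1 / cosh x = 2 * (\<Sum>n<N. (-1) ^ n * exp (- (2 * real n + 1) * x)) + (-1) ^ N * exp (- (2 * real N) * x) / cosh x"
proof -
  have "2 * cosh x * exp (- (2 * real n + 1) * x) = exp (- (2 * real n) * x) + exp (- (2 * real (Suc n)) * x)" for n
    by (simp add: cosh_field_def algebra_simps flip: exp_add)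
  then have "2 * cosh x * (\<Sum>n<N. (-1) ^ n * exp (- (2 * real n + 1) * x)) = 1 - (-1) ^ N * exp (- (2 * real N) * x)"
  proof (induction N)
    case (Suc N)
    then show ?case
      by (simp add: distrib_left mult.left_commute[of _ "(-1) ^ N"] del: of_nat_Suc)
  qed simp
  then show ?thesis
    using cosh_real_pos[of x] by (simp add: field_simps)
qed

lemma inverse_cosh_le_1: "1 / cosh (x::real) \<le> 1"
  using cosh_real_ge_1[of x] by (simp add: divide_le_eq)

text \<open>For nonnegative \<open>x\<close> the bound \<open>2 * exp (- x)\<close> dominates;
  evenness extends this to the whole line.\<close>

lemma integrable_inverse_cosh: "integrable lborel (\<lambda>x::real. 1 / cosh x)"
proof -
  have "integrable lborel (\<lambda>x::real. indicator {0..} x * (1 / cosh x))"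
  proof (rule Bochner_Integration.integrable_bound)
    show "integrable lborel (\<lambda>x::real. 2 * (indicator {0..} x * exp (- 1 * x)))"
      by (intro integrable_mult_right integrable.intros[OF has_bochner_integral_exp_minus_halfline]) simp
    have "1 / cosh x \<le> 2 * exp (- x)" for x :: real
      using cosh_real_pos[of x] by (simp add: divide_le_eq cosh_field_def algebra_simps flip: exp_add)
    then show "AE x::real in lborel. norm (indicator {0..} x * (1 / cosh x) :: real) \<le> norm (2 * (indicator {0..} x * exp (- 1 * x)))"
      by (auto simp: indicator_def)
  qed auto
  then have "has_bochner_integral lborel (\<lambda>x::real. indicator {0..} x *\<^sub>R (1 / cosh x))
      (\<integral>x. indicator {0..} x * (1 / cosh x) \<partial>lborel)"
    by (simp add: has_bochner_integral_iff)
  then show ?thesis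
    by (rule integrable.intros[OF has_bochner_integral_even_function]) simp
qed

text \<open>Integrating the finite expansion termwise gives partial sums of the secant series, and
  the remainder contributes at most the integral of \<open>exp (- (2 * real N) * x)\<close>, which
  tends to \<open>0\<close>.\<close>

lemma has_bochner_integral_sech_cos_halfline:
  fixes t :: real
  shows "has_bochner_integral lborel (\<lambda>x. indicator {0..} x * (cos (t * x) / cosh x)) (pi / (2 * cosh (pi * t / 2)))"
proof -
  have int: "integrable lborel (\<lambda>x. indicator {0..} x * (cos (t * x) / cosh x))"
    by (rule Bochner_Integration.integrable_bound[OF integrable_inverse_cosh])
       (auto simp: abs_mult indicator_def intro!: AE_I2 divide_right_mono)
  define I where "I = (\<integral>x. indicator {0..} x * (cos (t * x) / cosh x) \<partial>lborel)"
  define b where "b = (\<lambda>n. (-1) ^ n * (2 * real n + 1) / ((2 * real n + 1)\<^sup>2 + t\<^sup>2))"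
  \<comment> \<open>At \<open>N = 0\<close> the exponential bound is constant and not integrable,
    while the right-hand side would read \<open>0\<close> by division by zero.\<close>
  have bound: "\<bar>I - 2 * (\<Sum>n<N. b n)\<bar> \<le> 1 / (2 * real N)" if "N > 0" for N
  proof -
    have S: "has_bochner_integral lborel (\<lambda>x. \<Sum>n<N. (-1) ^ n * (indicator {0..} x * (exp (- (2 * real n + 1) * x) * cos (t * x))))
        (\<Sum>n<N. (-1) ^ n * ((2 * real n + 1) / ((2 * real n + 1)\<^sup>2 + t\<^sup>2)))"
      by (intro has_bochner_integral_sum has_bochner_integral_mult_right has_bochner_integral_exp_cos_halfline) auto
    have "has_bochner_integral lborel (\<lambda>x. indicator {0..} x * (cos (t * x) / cosh x)
         - 2 * (\<Sum>n<N. (-1) ^ n * (indicator {0..} x * (exp (- (2 * real n + 1) * x) * cos (t * x))))) (I - 2 * (\<Sum>n<N. b n))"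
      using has_bochner_integral_diff[OF has_bochner_integral_integrable[OF int] has_bochner_integral_mult_right[OF S, of 2]]
      by (simp add: I_def b_def)
    also have "(\<lambda>x. indicator {0..} x * (cos (t * x) / cosh x)
         - 2 * (\<Sum>n<N. (-1) ^ n * (indicator {0..} x * (exp (- (2 * real n + 1) * x) * cos (t * x)))))
       = (\<lambda>x. indicator {0..} x * (cos (t * x) * ((-1) ^ N * exp (- (2 * real N) * x) / cosh x)))"
    proof
      fix x :: real
      have "indicator {0..} x * (cos (t * x) / cosh x)
         - 2 * (\<Sum>n<N. (-1) ^ n * (indicator {0..} x * (exp (- (2 * real n + 1) * x) * cos (t * x))))
         = indicator {0..} x * (cos (t * x) * (1 / cosh x - 2 * (\<Sum>n<N. (-1) ^ n * exp (- (2 * real n + 1) * x))))"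
        by (cases "x \<ge> 0") (simp_all add: right_diff_distrib sum_distrib_left mult_ac)
      also have "1 / cosh x - 2 * (\<Sum>n<N. (-1) ^ n * exp (- (2 * real n + 1) * x)) = (-1) ^ N * exp (- (2 * real N) * x) / cosh x"
        using inverse_cosh_geometric[of x N] by linarith
      finally show "indicator {0..} x * (cos (t * x) / cosh x)
         - 2 * (\<Sum>n<N. (-1) ^ n * (indicator {0..} x * (exp (- (2 * real n + 1) * x) * cos (t * x))))
         = indicator {0..} x * (cos (t * x) * ((-1) ^ N * exp (- (2 * real N) * x) / cosh x))" .
    qed
    finally have rem: "has_bochner_integral lborel
       (\<lambda>x. indicator {0..} x * (cos (t * x) * ((-1) ^ N * exp (- (2 * real N) * x) / cosh x))) (I - 2 * (\<Sum>n<N. b n))" .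
    have exp: "has_bochner_integral lborel (\<lambda>x::real. indicator {0..} x * exp (- (2 * real N) * x)) (1 / (2 * real N))"
      using that by (intro has_bochner_integral_exp_minus_halfline) auto
    have "norm (I - 2 * (\<Sum>n<N. b n)) \<le> 1 / (2 * real N)"
      unfolding has_bochner_integral_integral_eq[OF rem, symmetric] has_bochner_integral_integral_eq[OF exp, symmetric]
    proof (rule Bochner_Integration.integral_norm_bound_integral)
      fix x :: real
      have "\<bar>cos (t * x)\<bar> * (exp (- (2 * real N) * x) * (1 / cosh x)) \<le> 1 * (exp (- (2 * real N) * x) * 1)"
        using inverse_cosh_le_1[of x] by (intro mult_mono) auto
      then show "norm (indicator {0..} x * (cos (t * x) * ((-1) ^ N * exp (- (2 * real N) * x) / cosh x)))
        \<le> indicator {0..} x * exp (- (2 * real N) * x)"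
        by (auto simp: indicator_def abs_mult power_abs)
    qed (use rem exp in \<open>auto simp: has_bochner_integral_iff\<close>)
    then show ?thesis by simp
  qed
  \<comment> \<open>Only even lengths are considered, as the secant series was summed along
    these.\<close>
  have "(\<lambda>m. I - 2 * (\<Sum>n<2*m. b n)) \<longlonglongrightarrow> 0"
  proof (rule Lim_null_comparison)
    show "\<forall>\<^sub>F m in sequentially. norm (I - 2 * (\<Sum>n<2*m. b n)) \<le> 1 / (2 * real (2 * m))"
      using eventually_gt_at_top[of 0]
    proof eventually_elim
      case (elim m)
      then show ?case using bound[of "2 * m"] by simp
    qed
    show "(\<lambda>m. 1 / (2 * real (2 * m))) \<longlonglongrightarrow> 0"
      by real_asymp
  qed
  moreover have "(\<lambda>m. I - 2 * (\<Sum>n<2*m. b n)) \<longlonglongrightarrow> I - 2 * (pi / (4 * cosh (pi * t / 2)))"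
    unfolding b_def by (intro tendsto_intros sech_partial_fractions)
  ultimately have "I = pi / (2 * cosh (pi * t / 2))"
    using LIMSEQ_unique by fastforce
  then show ?thesis
    using int by (simp add: I_def has_bochner_integral_iff)
qed

lemma has_bochner_integral_sech_cos:
  fixes t :: real
  shows "has_bochner_integral lborel (\<lambda>x. cos (t * x) / cosh x) (pi / cosh (pi * t / 2))"
  using has_bochner_integral_even_function[of "\<lambda>x. cos (t * x) / cosh x", OF _ _] has_bochner_integral_sech_cos_halfline[of t]
  by fastforce

section \<open>Fubini's theorem and the Gaussian case\<close>

text \<open>Write \<open>pi / cosh x\<close> as the cosine transform of the secant at
  \<open>t = 2 / pi * x\<close>, for which \<open>pi * t / 2 = x\<close>, and exchange the
  integrals; \<open>\<bar>g x\<bar> / cosh u\<close> is an integrable majorant.\<close>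

lemma integral_over_cosh_eq_cos_transform:
  fixes g :: "real \<Rightarrow> real"
  assumes "integrable lborel g"
  shows "pi * (\<integral>x. g x / cosh x \<partial>lborel)
    = (\<integral>u. (\<integral>x. g x * cos (2 / pi * u * x) \<partial>lborel) / cosh u \<partial>lborel)"
proof -
  have [measurable]: "g \<in> borel_measurable borel"
    using assms by auto
  let ?f = "\<lambda>x u. g x * (cos (2 / pi * x * u) / cosh u)"
  have "integrable (lborel \<Otimes>\<^sub>M lborel) (\<lambda>(x, u). ?f x u)"
  proof (rule lborel_pair.Fubini_integrable)
    show "integrable lborel (\<lambda>x. \<integral>u. norm (case (x, u) of (x, u) \<Rightarrow> ?f x u) \<partial>lborel)"
    proof (rule Bochner_Integration.integrable_bound)
      show "integrable lborel (\<lambda>x. g x * (\<integral>u. 1 / cosh u \<partial>lborel))"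
        using assms by simp
      have "(\<integral>u. \<bar>?f x u\<bar> \<partial>lborel) \<le> \<bar>g x\<bar> * (\<integral>u. 1 / cosh u \<partial>lborel)" for x
      proof -
        have "(\<integral>u. \<bar>?f x u\<bar> \<partial>lborel) \<le> (\<integral>u. \<bar>g x\<bar> * (1 / cosh u) \<partial>lborel)"
        proof (rule Bochner_Integration.integral_mono)
          show "integrable lborel (\<lambda>u. \<bar>?f x u\<bar>)"
            by (intro integrable_abs integrable_mult_right integrable.intros[OF has_bochner_integral_sech_cos])
          show "integrable lborel (\<lambda>u. \<bar>g x\<bar> * (1 / cosh u))"
            by (intro integrable_mult_right integrable_inverse_cosh)
          show "\<bar>?f x u\<bar> \<le> \<bar>g x\<bar> * (1 / cosh u)" for u
            unfolding abs_mult abs_divide by (intro mult_left_mono divide_mono) auto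
        qed
        then show ?thesis by (simp only: integral_mult_right_zero)
      qed
      moreover have "norm (\<integral>u. \<bar>?f x u\<bar> \<partial>lborel) = (\<integral>u. \<bar>?f x u\<bar> \<partial>lborel)" for x
        unfolding real_norm_def by (rule abs_of_nonneg, rule Bochner_Integration.integral_nonneg, rule abs_ge_zero)
      moreover have "norm (g x * (\<integral>u. 1 / cosh u \<partial>lborel)) = \<bar>g x\<bar> * (\<integral>u. 1 / cosh u \<partial>lborel)" for x
        unfolding real_norm_def abs_mult by (subst abs_of_nonneg) (auto intro!: Bochner_Integration.integral_nonneg)
      ultimately show "AE x in lborel. norm (\<integral>u. norm (case (x, u) of (x, u) \<Rightarrow> ?f x u) \<partial>lborel)
          \<le> norm (g x * (\<integral>u. 1 / cosh u \<partial>lborel))"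
        by (intro AE_I2) (simp only: prod.case real_norm_def)
    qed auto
    show "AE x in lborel. integrable lborel (\<lambda>u. case (x, u) of (x, u) \<Rightarrow> ?f x u)"
      unfolding prod.case
      by (intro AE_I2 integrable_mult_right integrable.intros[OF has_bochner_integral_sech_cos])
  qed auto
  from lborel_pair.Fubini_integral[OF this]
  have "(\<integral>u. (\<integral>x. ?f x u \<partial>lborel) \<partial>lborel) = (\<integral>x. (\<integral>u. ?f x u \<partial>lborel) \<partial>lborel)" .
  also have "(\<lambda>x. \<integral>u. ?f x u \<partial>lborel) = (\<lambda>x. pi * (g x / cosh x))"
  proof
    fix x
    have "(\<integral>u. ?f x u \<partial>lborel) = g x * (pi / cosh (pi * (2 / pi * x) / 2))"
      by (simp only: integral_mult_right_zero has_bochner_integral_integral_eq[OF has_bochner_integral_sech_cos])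
    then show "(\<integral>u. ?f x u \<partial>lborel) = pi * (g x / cosh x)"
      by (simp add: mult.commute)
  qed
  also have "(\<lambda>u. \<integral>x. ?f x u \<partial>lborel) = (\<lambda>u. (\<integral>x. g x * cos (2 / pi * u * x) \<partial>lborel) / cosh u)"
  proof
    fix u
    have "?f x u = g x * cos (2 / pi * u * x) / cosh u" for x
      by (simp add: mult.assoc mult.commute[of u])
    then show "(\<integral>x. ?f x u \<partial>lborel) = (\<integral>x. g x * cos (2 / pi * u * x) \<partial>lborel) / cosh u"
      by (simp only: integral_divide_zero)
  qed
  finally show ?thesis
    by (simp only: integral_mult_right_zero)
qed

lemma gaussian_sech_integrable:
  fixes a :: real
  assumes "a > 0"
  shows "integrable lborel (\<lambda>x. x ^ k * exp (- a * x\<^sup>2) / cosh x)"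
proof (rule Bochner_Integration.integrable_bound[OF gaussian_moment_integrable[OF assms, of k]])
  show "AE x in lborel. norm (x ^ k * exp (- a * x\<^sup>2) / cosh x) \<le> norm (x ^ k * exp (- a * x\<^sup>2))"
    using mult_left_mono[OF inverse_cosh_le_1] by (auto simp: abs_mult)
qed auto

text \<open>Bridge from Lebesgue integrals over the line, where the transforms live, to the gauge
  integrals over \<open>{0..}\<close> of the final claim.\<close>

lemma has_integral_even_halfline:
  fixes f :: "real \<Rightarrow> real"
  assumes "integrable lborel f" and "\<And>x. f (- x) = f x"
  shows "(f has_integral (\<integral>x. f x \<partial>lborel) / 2) {0..}"
proof -
  have int: "integrable lborel (\<lambda>x. indicator {0..} x *\<^sub>R f x)"
    using assms(1) by (intro integrable_mult_indicator) auto
  have "has_bochner_integral lborel f (2 *\<^sub>R (\<integral>x. indicator {0..} x *\<^sub>R f x \<partial>lborel))"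
    using int assms(2) by (intro has_bochner_integral_even_function) (auto simp: has_bochner_integral_iff)
  then have "(\<integral>x. f x \<partial>lborel) / 2 = (\<integral>x. indicator {0..} x *\<^sub>R f x \<partial>lborel)"
    by (simp add: has_bochner_integral_iff)
  moreover have "(f has_integral (LINT x : {0..} | lborel. f x)) {0..}"
    using set_borel_integral_eq_integral[of "{0..}" f] int by (simp add: has_integral_iff set_integrable_def)
  ultimately show ?thesis
    by (simp add: set_lebesgue_integral_def)
qed

lemma gaussian_sech_sq_integral:
  fixes p :: real
  assumes "p > 0"
  shows "sqrt pi * (\<integral>x. x\<^sup>2 * exp (- (1 / p) * x\<^sup>2) / cosh x \<partial>lborel)
     + p\<^sup>2 * sqrt p / pi\<^sup>2 * (\<integral>x. x\<^sup>2 * exp (- (p / pi\<^sup>2) * x\<^sup>2) / cosh x \<partial>lborel)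
     = p * sqrt p / 2 * (\<integral>x. exp (- (p / pi\<^sup>2) * x\<^sup>2) / cosh x \<partial>lborel)"
proof -
  let ?e = "\<lambda>x. exp (- (p / pi\<^sup>2) * x\<^sup>2)"
  have q: "p / pi\<^sup>2 > 0" using assms by simp
  note int = gaussian_sech_integrable[OF q, of 0, unfolded power_0 mult_1] gaussian_sech_integrable[OF q, of 2]
  have "pi * (\<integral>x. x\<^sup>2 * exp (- (1 / p) * x\<^sup>2) / cosh x \<partial>lborel)
     = (\<integral>u. (\<integral>x. x\<^sup>2 * exp (- (1 / p) * x\<^sup>2) * cos (2 / pi * u * x) \<partial>lborel) / cosh u \<partial>lborel)"
    using assms by (intro integral_over_cosh_eq_cos_transform gaussian_moment_integrable) auto
  \<comment> \<open>The transform of the quadratic Gaussian moment with \<open>a = 1 / p\<close>, at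
    \<open>t = 2 / pi * u\<close>. The factor \<open>sqrt pi\<close> is split off because it later
    cancels against one factor of \<open>pi = sqrt pi * sqrt pi\<close> on the left.\<close>
  also have "\<dots> = (\<integral>u. sqrt pi * (p * sqrt p / 2 * (?e u / cosh u) - p\<^sup>2 * sqrt p / pi\<^sup>2 * (u\<^sup>2 * ?e u / cosh u)) \<partial>lborel)"
  proof (intro Bochner_Integration.integral_cong refl)
    fix u :: real
    have "(\<integral>x. x\<^sup>2 * exp (- (1 / p) * x\<^sup>2) * cos (2 / pi * u * x) \<partial>lborel)
      = (p / 2 - u\<^sup>2 * p\<^sup>2 / pi\<^sup>2) * (sqrt (pi * p) * ?e u)"
      using assms by (subst gaussian_sq_cos_integral) (auto simp: power_mult_distrib power_divide mult_ac)
    then show "(\<integral>x. x\<^sup>2 * exp (- (1 / p) * x\<^sup>2) * cos (2 / pi * u * x) \<partial>lborel) / cosh u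
      = sqrt pi * (p * sqrt p / 2 * (?e u / cosh u) - p\<^sup>2 * sqrt p / pi\<^sup>2 * (u\<^sup>2 * ?e u / cosh u))"
      by (simp add: real_sqrt_mult field_simps)
  qed
  also have "\<dots> = sqrt pi * (p * sqrt p / 2 * (\<integral>u. ?e u / cosh u \<partial>lborel)
      - p\<^sup>2 * sqrt p / pi\<^sup>2 * (\<integral>u. u\<^sup>2 * ?e u / cosh u \<partial>lborel))"
    by (subst integral_mult_right_zero, subst Bochner_Integration.integral_diff,
        (intro integrable_mult_right int)+, simp only: integral_mult_right_zero)
  finally have "sqrt pi * (sqrt pi * (\<integral>x. x\<^sup>2 * exp (- (1 / p) * x\<^sup>2) / cosh x \<partial>lborel))
     = sqrt pi * (p * sqrt p / 2 * (\<integral>u. ?e u / cosh u \<partial>lborel)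
      - p\<^sup>2 * sqrt p / pi\<^sup>2 * (\<integral>u. u\<^sup>2 * ?e u / cosh u \<partial>lborel))"
    by (simp flip: mult.assoc)
  then show ?thesis
    by (subst (asm) mult_left_cancel) auto
qed

theorem mainTheorem16:
  fixes p :: real
  assumes "p > 0"
  shows "(\<lambda>x::real. (sqrt pi * exp (- x\<^sup>2 / p) + p\<^sup>2 * sqrt p * pi powi (-2) * exp (- p * x\<^sup>2 / pi\<^sup>2))
             * (x\<^sup>2 / cosh x)) integrable_on {0..}
    \<and> (\<lambda>x::real. exp (- p * x\<^sup>2) / cosh (pi * x)) integrable_on {0..}
    \<and> integral {0..} (\<lambda>x::real. (sqrt pi * exp (- x\<^sup>2 / p) + p\<^sup>2 * sqrt p * pi powi (-2) * exp (- p * x\<^sup>2 / pi\<^sup>2))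
             * (x\<^sup>2 / cosh x))
         = p * pi * sqrt p / 2 * integral {0..} (\<lambda>x::real. exp (- p * x\<^sup>2) / cosh (pi * x))"
proof -
  define A B C where "A = (\<integral>x. x\<^sup>2 * exp (- (1 / p) * x\<^sup>2) / cosh x \<partial>lborel)"
    and "B = (\<integral>x. x\<^sup>2 * exp (- (p / pi\<^sup>2) * x\<^sup>2) / cosh x \<partial>lborel)"
    and "C = (\<integral>x. exp (- (p / pi\<^sup>2) * x\<^sup>2) / cosh x \<partial>lborel)"
  have pos: "1 / p > 0" "p / pi\<^sup>2 > 0" using assms by auto
  note int = gaussian_sech_integrable[OF pos(1), of 2] gaussian_sech_integrable[OF pos(2), of 2]
    gaussian_sech_integrable[OF pos(2), of 0]
  have "((\<lambda>x. x\<^sup>2 * exp (- (1 / p) * x\<^sup>2) / cosh x) has_integral A / 2) {0..}"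
    "((\<lambda>x. x\<^sup>2 * exp (- (p / pi\<^sup>2) * x\<^sup>2) / cosh x) has_integral B / 2) {0..}"
    unfolding A_def B_def using int by (auto intro!: has_integral_even_halfline)
  then have "((\<lambda>x. sqrt pi * (x\<^sup>2 * exp (- (1 / p) * x\<^sup>2) / cosh x)
       + p\<^sup>2 * sqrt p / pi\<^sup>2 * (x\<^sup>2 * exp (- (p / pi\<^sup>2) * x\<^sup>2) / cosh x)) has_integral
       sqrt pi * (A / 2) + p\<^sup>2 * sqrt p / pi\<^sup>2 * (B / 2)) {0..}"
    by (intro has_integral_add has_integral_mult_right)
  also have "(\<lambda>x. sqrt pi * (x\<^sup>2 * exp (- (1 / p) * x\<^sup>2) / cosh x)
       + p\<^sup>2 * sqrt p / pi\<^sup>2 * (x\<^sup>2 * exp (- (p / pi\<^sup>2) * x\<^sup>2) / cosh x))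
     = (\<lambda>x. (sqrt pi * exp (- x\<^sup>2 / p) + p\<^sup>2 * sqrt p * pi powi (-2) * exp (- p * x\<^sup>2 / pi\<^sup>2))
             * (x\<^sup>2 / cosh x))"
    by (simp add: fun_eq_iff power_int_minus divide_inverse algebra_simps)
  also have "sqrt pi * (A / 2) + p\<^sup>2 * sqrt p / pi\<^sup>2 * (B / 2) = p * sqrt p / 4 * C"
  proof -
    have eq: "sqrt pi * A + p\<^sup>2 * sqrt p / pi\<^sup>2 * B = p * sqrt p / 2 * C"
      unfolding A_def B_def C_def by (rule gaussian_sech_sq_integral[OF assms])
    have "(sqrt pi * A + p\<^sup>2 * sqrt p / pi\<^sup>2 * B) / 2 = p * sqrt p / 4 * C"
      unfolding eq by simp
    then show ?thesis by (simp only: add_divide_distrib times_divide_eq_right)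
  qed
  finally have lhs: "((\<lambda>x. (sqrt pi * exp (- x\<^sup>2 / p) + p\<^sup>2 * sqrt p * pi powi (-2) * exp (- p * x\<^sup>2 / pi\<^sup>2))
             * (x\<^sup>2 / cosh x)) has_integral p * sqrt p / 4 * C) {0..}" .
  \<comment> \<open>The substitution of \<open>pi * x\<close> for \<open>x\<close> turns the
    Gaussian exponent into \<open>- p * x\<^sup>2\<close> and contributes the factor
    \<open>1 / pi\<close>; the summand \<open>0\<close> only fits the affine substitution
    rule.\<close>
  have "has_bochner_integral lborel (\<lambda>x. exp (- (p / pi\<^sup>2) * (0 + pi * x)\<^sup>2) / cosh (0 + pi * x)) (C /\<^sub>R \<bar>pi\<bar>)"
    using int(3) by (subst lborel_has_bochner_integral_real_affine_iff[symmetric, where f="\<lambda>x. exp (- (p / pi\<^sup>2) * x\<^sup>2) / cosh x"])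
      (auto simp: C_def has_bochner_integral_iff)
  also have "(\<lambda>x. exp (- (p / pi\<^sup>2) * (0 + pi * x)\<^sup>2) / cosh (0 + pi * x)) = (\<lambda>x. exp (- p * x\<^sup>2) / cosh (pi * x))"
    by (simp add: power_mult_distrib)
  finally have "integrable lborel (\<lambda>x. exp (- p * x\<^sup>2) / cosh (pi * x))"
    and val: "(\<integral>x. exp (- p * x\<^sup>2) / cosh (pi * x) \<partial>lborel) = C / pi"
    by (simp_all add: has_bochner_integral_iff divide_inverse mult.commute)
  then have rhs: "((\<lambda>x. exp (- p * x\<^sup>2) / cosh (pi * x)) has_integral C / pi / 2) {0..}"
    unfolding val[symmetric] by (intro has_integral_even_halfline) simp_all
  have "p * sqrt p / 4 * C = p * pi * sqrt p / 2 * (C / pi / 2)"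
    by simp
  with lhs rhs show ?thesis
    by (simp only: has_integral_iff simp_thms)
qed
end
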